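(* Let $G$ be a group with finite generating set $\Sigma$, and fix a total order on $\Sigma\cup\Sigma^{-1}$. If $G$ satisfies the falsification by fellow traveller property (FFTP) with respect to $\Sigma$, then $G$ satisfies the shortlex falsification by fellow traveller property (SL-FFTP) with respect to $\Sigma$ (and the fixed order).
   Context: $\Sigma\cup\Sigma^{-1}$ is regarded as a finite subset of $G$, and $(\Sigma\cup\Sigma^{-1})^*$ is the set of finite words over it; $|w|$ is the length of a word $w$, and $w=_Gv$ means that $w$ and $v$ represent the same element of $G$. Shortlex order. For words $w_1,w_2$ over a totally ordered alphabet $(S,<)$: $w_1<_{\mathrm{lex}}w_2$ iff $w_1$ is a strict prefix of $w_2$ or, in the first position where they differ, the letter of $w_1$ is smaller than that of $w_2$; $w_1<_{\mathrm{SL}}w_2$ iff $|w_1|<|w_2|$, or $|w_1|=|w_2|$ and $w_1<_{\mathrm{lex}}w_2$. The order $<_{\mathrm{SL}}$ is a well-ordering. For $g\in G$, $\mathrm{SL}(g)$ is the $<_{\mathrm{SL}}$-minimal word in $(\Sigma\cup\Sigma^{-1})^*$ representing $g$, and $\mathrm{SL}_G=\{\mathrm{SL}(g):g\in G\}$. Fellow travelling. A word $w=s_1\cdots s_n$ determines the path in the Cayley graph of $G$ with respect to $\Sigma$ with vertices $v_0=1_G$, $v_i=s_1\cdots s_i$. For $K\ge 0$, two paths with vertex sequences $v_0,\dots,v_n$ and $u_0,\dots,u_m$ asynchronously $K$-fellow travel if there are non-decreasing maps $f:\{0,\dots,n\}\to\{0,\dots,m\}$ and $g:\{0,\dots,m\}\to\{0,\dots,n\}$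 such that $d(v_i,u_{f(i)})\le K$ for all $i$ and $d(u_j,v_{g(j)})\le K$ for all $j$, where $d$ is the graph distance. Two words asynchronously $K$-fellow travel if their paths starting at $1_G$ do. FFTP. $G$ has FFTP with respect to $\Sigma$ if there is a constant $K$ such that for every non-geodesic path $p$ in the Cayley graph of $G$ with respect to $\Sigma$ there is a path $q$ with the same endpoints as $p$, shorter than $p$, that asynchronously $K$-fellow travels with $p$. SL-FFTP. $G$ has SL-FFTP with respect to $\Sigma$ (and the order $<$ on $\Sigma\cup\Sigma^{-1}$) if there is a constant $K\ge0$ such that for every word $w\in(\Sigma\cup\Sigma^{-1})^*$ with $w\notin\mathrm{SL}_G$ there is a word $v\in(\Sigma\cup\Sigma^{-1})^*$ that asynchronously $K$-fellow travels with $w$ and satisfies $w=_Gv$ and $v<_{\mathrm{SL}}w$. *)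

theory Defs
  imports
    "HOL-Algebra.Generated_Groups"
    "Graph_Theory.Vertex_Walk"
begin

definition sym_gens :: "('a, 'b) monoid_scheme \<Rightarrow> 'a set \<Rightarrow> 'a set" where
  "sym_gens G \<Sigma> = \<Sigma> \<union> m_inv G ` \<Sigma>"

(* Words are lists in lists (sym_gens G \<Sigma>); letters are group elements, so that
   letters equal in G are identified. *)
definition word_val :: "('a, 'b) monoid_scheme \<Rightarrow> 'a list \<Rightarrow> 'a" where
  "word_val G w = foldr (mult G) w \<one>\<^bsub>G\<^esub>"

(* The undirected Cayley graph is represented as a symmetric digraph. It has a loop at
   every vertex if \<one> is a generator, so every word labels a walk. Since the letters are
   elements of G, the label of an edge is determined by its end points and there are no
   multiple edges. *)
definition cayley_graph ::
    "('a, 'b) monoid_scheme \<Rightarrow> 'a set \<Rightarrow> ('a, 'a \<times> 'a) pre_digraph" where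
  "cayley_graph G \<Sigma> =
     \<lparr> verts = carrier G,
       arcs = {(g, g \<otimes>\<^bsub>G\<^esub> s) | g s. g \<in> carrier G \<and> s \<in> sym_gens G \<Sigma>},
       tail = fst, head = snd \<rparr>"

(* Meaningful for vertices joined by a walk; the Cayley graph is connected
   when \<Sigma> generates G. *)
definition graph_dist :: "('a, 'b) pre_digraph \<Rightarrow> 'a \<Rightarrow> 'a \<Rightarrow> nat" where
  "graph_dist \<Gamma> u v =
     (LEAST n. \<exists>p. vwalk p \<Gamma> \<and> hd p = u \<and> last p = v \<and> vwalk_length p = n)"

definition geodesic :: "('a, 'b) pre_digraph \<Rightarrow> 'a list \<Rightarrow> bool" where
  "geodesic \<Gamma> p \<longleftrightarrow> vwalk p \<Gamma> \<and> vwalk_length p = graph_dist \<Gamma> (hd p) (last p)"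

definition word_path :: "('a, 'b) monoid_scheme \<Rightarrow> 'a list \<Rightarrow> 'a list" where
  "word_path G w = map (\<lambda>i. word_val G (take i w)) [0..<Suc (length w)]"

(* For vertex sequences v = [v_0, ..., v_n] and u = [u_0, ..., u_m], so that
   n = vwalk_length v and m = vwalk_length u. As graph distances are natural numbers,
   it is no restriction that K is one, too. *)
definition async_fellow_travel ::
    "('a, 'b) pre_digraph \<Rightarrow> nat \<Rightarrow> 'a list \<Rightarrow> 'a list \<Rightarrow> bool" where
  "async_fellow_travel \<Gamma> K v u \<longleftrightarrow>
     (\<exists>f g. f \<in> {0..vwalk_length v} \<rightarrow> {0..vwalk_length u} \<and> mono_on {0..vwalk_length v} f \<and>
            g \<in> {0..vwalk_length u} \<rightarrow> {0..vwalk_length v} \<and> mono_on {0..vwalk_length u} g \<and>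
            (\<forall>i\<in>{0..vwalk_length v}. graph_dist \<Gamma> (v ! i) (u ! f i) \<le> K) \<and>
            (\<forall>j\<in>{0..vwalk_length u}. graph_dist \<Gamma> (u ! j) (v ! g j) \<le> K))"

definition FFTP :: "('a, 'b) monoid_scheme \<Rightarrow> 'a set \<Rightarrow> bool" where
  "FFTP G \<Sigma> \<longleftrightarrow>
     (\<exists>K. \<forall>p. vwalk p (cayley_graph G \<Sigma>) \<and> \<not> geodesic (cayley_graph G \<Sigma>) p \<longrightarrow>
        (\<exists>q. vwalk q (cayley_graph G \<Sigma>) \<and> hd q = hd p \<and> last q = last p \<and>
             vwalk_length q < vwalk_length p \<and>
             async_fellow_travel (cayley_graph G \<Sigma>) K p q))"

(* The shortlex order induced by a strict order r on the letters is the library's lenlex r. *)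
lemma lenlex_iff_lexord:
  "(w1, w2) \<in> lenlex r \<longleftrightarrow>
     length w1 < length w2 \<or> length w1 = length w2 \<and> (w1, w2) \<in> lexord r"
  by (auto simp: lenlex_conv lexord_lex)

definition shortlex_rep ::
    "('a, 'b) monoid_scheme \<Rightarrow> 'a set \<Rightarrow> ('a \<times> 'a) set \<Rightarrow> 'a \<Rightarrow> 'a list" where
  "shortlex_rep G \<Sigma> r g =
     (THE w. w \<in> lists (sym_gens G \<Sigma>) \<and> word_val G w = g \<and>
             (\<forall>v \<in> lists (sym_gens G \<Sigma>). word_val G v = g \<longrightarrow> w = v \<or> (w, v) \<in> lenlex r))"

definition shortlex_words ::
    "('a, 'b) monoid_scheme \<Rightarrow> 'a set \<Rightarrow> ('a \<times> 'a) set \<Rightarrow> 'a list set" where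
  "shortlex_words G \<Sigma> r = shortlex_rep G \<Sigma> r ` carrier G"

definition SL_FFTP ::
    "('a, 'b) monoid_scheme \<Rightarrow> 'a set \<Rightarrow> ('a \<times> 'a) set \<Rightarrow> bool" where
  "SL_FFTP G \<Sigma> r \<longleftrightarrow>
     (\<exists>K. \<forall>w \<in> lists (sym_gens G \<Sigma>). w \<notin> shortlex_words G \<Sigma> r \<longrightarrow>
        (\<exists>v \<in> lists (sym_gens G \<Sigma>).
           async_fellow_travel (cayley_graph G \<Sigma>) K (word_path G w) (word_path G v) \<and>
           word_val G w = word_val G v \<and> (v, w) \<in> lenlex r))"

end

theory Submission
  imports Defs
begin

text \<open>
  If \<open>w = x a w'\<close> is larger than an equal word \<open>u = x b u'\<close> of the same length, with \<open>b < a\<close>, then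
  \<open>b\<inverse> a w'\<close> is a word of length \<open>|u'| + 2\<close> representing the same element as \<open>u'\<close>. Applying FFTP
  to it at most twice, starting at the vertex \<open>x b\<close>, yields a word \<open>q\<close> with \<open>|q| \<le> |u'|\<close> that
  \<open>2K\<close>-fellow travels with it; then \<open>x b q\<close> is smaller than \<open>w\<close> and \<open>(2K + 1)\<close>-fellow travels
  with \<open>w\<close>.
\<close>

section \<open>Totality of the shortlex order\<close>

text \<open>Unequal lengths decide the comparison at once; for equal lengths the first pair of
  differing letters does, which is the induction. Totality is relative to \<open>A\<close> because
  \<open>r\<close> orders only the letters, not all elements of the type.\<close>

lemma total_on_lenlex:
  assumes "total_on A r"
  shows "total_on (lists A) (lenlex r)"
proof -
  have "xs = ys \<or> (xs, ys) \<in> lenlex r \<or> (ys, xs) \<in> lenlex r"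
    if "length xs = length ys" "xs \<in> lists A" "ys \<in> lists A" for xs ys
    using that
  proof (induction xs ys rule: list_induct2)
    case (Cons x xs y ys)
    then show ?case using assms by (auto simp: Cons_lenlex_iff total_on_def)
  qed simp
  then show ?thesis
    unfolding total_on_def by (metis (no_types, lifting) lenlex_iff_lexord nat_neq_iff)
qed

section \<open>Asynchronous fellow travelling in an arbitrary digraph\<close>

text \<open>The identity serves as both reparametrisations. Index 0 always lies in
  \<open>{0..vwalk_length p}\<close>, so \<open>p\<close> has to be nonempty for
  \<open>p ! 0\<close> to be a vertex of it.\<close>

lemma async_fellow_travel_refl:
  assumes "\<And>x. x \<in> set p \<Longrightarrow> graph_dist \<Gamma> x x = 0" and "p \<noteq> []"
  shows "async_fellow_travel \<Gamma> 0 p p"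
  unfolding async_fellow_travel_def
proof (intro exI[of _ id] conjI ballI)
  fix i assume "i \<in> {0..vwalk_length p}"
  then have "p ! i \<in> set p" using assms(2)
    by (intro nth_mem) (cases p; auto)
  then show "graph_dist \<Gamma> (p ! i) (p ! id i) \<le> 0"
    using assms(1) by auto
next
  fix i assume "i \<in> {0..vwalk_length p}"
  then have "p ! i \<in> set p" using assms(2)
    by (intro nth_mem) (cases p; auto)
  then show "graph_dist \<Gamma> (p ! i) (p ! id i) \<le> 0"
    using assms(1) by auto
qed (auto intro: mono_onI)

lemma async_fellow_travel_mono:
  assumes "async_fellow_travel \<Gamma> K p q" and "K \<le> L"
  shows "async_fellow_travel \<Gamma> L p q"
  using assms unfolding async_fellow_travel_def by (meson le_trans)

text \<open>The reparametrisations compose, in opposite orders for the two directions, and the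
  constants add by the triangle inequality. That inequality is assumed only on a set
  \<open>A\<close> containing the vertices, since \<open>graph_dist\<close> is unspecified between
  vertices not joined by a walk.\<close>

lemma async_fellow_travel_trans:
  assumes pq: "async_fellow_travel \<Gamma> K p q" and qr: "async_fellow_travel \<Gamma> L q r"
    and ne: "p \<noteq> []" "q \<noteq> []" "r \<noteq> []"
    and sub: "set p \<subseteq> A" "set q \<subseteq> A" "set r \<subseteq> A"
    and triangle: "\<And>x y z. \<lbrakk>x \<in> A; y \<in> A; z \<in> A\<rbrakk> \<Longrightarrow>
      graph_dist \<Gamma> x z \<le> graph_dist \<Gamma> x y + graph_dist \<Gamma> y z"
  shows "async_fellow_travel \<Gamma> (K + L) p r"
proof -
  let ?I = "\<lambda>p :: 'a list. {0..vwalk_length p}"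
  have in_A: "p ! i \<in> A" if "p \<noteq> []" "set p \<subseteq> A" "i \<in> ?I p" for p :: "'a list" and i
  proof -
    have "i < length p" using that by (cases p) auto
    then show ?thesis using that(2) nth_mem by blast
  qed
  obtain f g where f: "f \<in> ?I p \<rightarrow> ?I q" "mono_on (?I p) f" and g: "g \<in> ?I q \<rightarrow> ?I p" "mono_on (?I q) g"
    and fK: "\<And>i. i \<in> ?I p \<Longrightarrow> graph_dist \<Gamma> (p ! i) (q ! f i) \<le> K"
    and gK: "\<And>i. i \<in> ?I q \<Longrightarrow> graph_dist \<Gamma> (q ! i) (p ! g i) \<le> K"
    using pq unfolding async_fellow_travel_def by blast
  obtain f' g' where f': "f' \<in> ?I q \<rightarrow> ?I r" "mono_on (?I q) f'"
    and g': "g' \<in> ?I r \<rightarrow> ?I q" "mono_on (?I r) g'"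
    and f'L: "\<And>i. i \<in> ?I q \<Longrightarrow> graph_dist \<Gamma> (q ! i) (r ! f' i) \<le> L"
    and g'L: "\<And>i. i \<in> ?I r \<Longrightarrow> graph_dist \<Gamma> (r ! i) (q ! g' i) \<le> L"
    using qr unfolding async_fellow_travel_def by blast
  show ?thesis unfolding async_fellow_travel_def
  proof (rule exI[of _ "f' \<circ> f"], rule exI[of _ "g \<circ> g'"], intro conjI ballI)
    show "f' \<circ> f \<in> ?I p \<rightarrow> ?I r" "g \<circ> g' \<in> ?I r \<rightarrow> ?I p"
      using f(1) f'(1) g(1) g'(1) by auto
    show "mono_on (?I p) (f' \<circ> f)"
      by (intro monotone_on_o[OF f'(2) f(2)] funcset_image f(1))
    show "mono_on (?I r) (g \<circ> g')"
      by (intro monotone_on_o[OF g(2) g'(2)] funcset_image g'(1))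
  next
    fix i assume i: "i \<in> ?I p"
    then have fi: "f i \<in> ?I q" using f(1) by blast
    then have "f' (f i) \<in> ?I r" using f'(1) by blast
    then have "graph_dist \<Gamma> (p ! i) (r ! f' (f i))
        \<le> graph_dist \<Gamma> (p ! i) (q ! f i) + graph_dist \<Gamma> (q ! f i) (r ! f' (f i))"
      by (intro triangle in_A ne sub i fi)
    then show "graph_dist \<Gamma> (p ! i) (r ! (f' \<circ> f) i) \<le> K + L"
      using fK[OF i] f'L[OF fi] by simp
  next
    fix i assume i: "i \<in> ?I r"
    then have gi: "g' i \<in> ?I q" using g'(1) by blast
    then have "g (g' i) \<in> ?I p" using g(1) by blast
    then have "graph_dist \<Gamma> (r ! i) (p ! g (g' i))
        \<le> graph_dist \<Gamma> (r ! i) (q ! g' i) + graph_dist \<Gamma> (q ! g' i) (p ! g (g' i))"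
      by (intro triangle in_A ne sub i gi)
    then show "graph_dist \<Gamma> (r ! i) (p ! (g \<circ> g') i) \<le> K + L"
      using gK[OF gi] g'L[OF i] by simp
  qed
qed

section \<open>Words as labels of walks in the Cayley graph\<close>

text \<open>Generalises \<open>word_path\<close> to an arbitrary initial vertex, because FFTP is
  applied later at the vertex reached by \<open>x b\<close>. The recursion follows the word and so
  supports induction on it.\<close>

primrec labelled_walk :: "('a, 'b) monoid_scheme \<Rightarrow> 'a \<Rightarrow> 'a list \<Rightarrow> 'a list" where
  "labelled_walk G g [] = [g]"
| "labelled_walk G g (s # w) = g # labelled_walk G (g \<otimes>\<^bsub>G\<^esub> s) w"

lemma length_labelled_walk [simp]: "length (labelled_walk G g w) = Suc (length w)"
  by (induction w arbitrary: g) auto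

lemma labelled_walk_not_Nil [simp]: "labelled_walk G g w \<noteq> []"
  by (cases w) auto

lemma hd_labelled_walk [simp]: "hd (labelled_walk G g w) = g"
  by (cases w) auto

locale cayley = group G for G :: "('a, 'b) monoid_scheme" (structure) +
  fixes \<Sigma> :: "'a set"
  assumes gens_closed: "\<Sigma> \<subseteq> carrier G" and gens_generate: "generate G \<Sigma> = carrier G"
begin

abbreviation "letters \<equiv> sym_gens G \<Sigma>"
abbreviation "cgraph \<equiv> cayley_graph G \<Sigma>"
abbreviation "cdist \<equiv> graph_dist cgraph"

lemma letters_closed: "s \<in> letters \<Longrightarrow> s \<in> carrier G"
  using gens_closed by (auto simp: sym_gens_def)

lemma inv_letters: "s \<in> letters \<Longrightarrow> inv s \<in> letters"
  using gens_closed by (auto simp: sym_gens_def subset_iff)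

lemma word_val_Nil [simp]: "word_val G [] = \<one>"
  by (simp add: word_val_def)

lemma word_val_Cons [simp]: "word_val G (s # w) = s \<otimes> word_val G w"
  by (simp add: word_val_def)

lemma word_val_closed: "w \<in> lists letters \<Longrightarrow> word_val G w \<in> carrier G"
  by (induction w) (auto simp: letters_closed)

lemma word_val_append:
  assumes "w \<in> lists letters" "v \<in> lists letters"
  shows "word_val G (w @ v) = word_val G w \<otimes> word_val G v"
  using assms by (induction w) (auto simp: word_val_closed letters_closed m_assoc)

text \<open>Besides products, \<open>generate\<close> admits inverses of generators only, and these
  are letters.\<close>

lemma word_val_surj:
  assumes "g \<in> carrier G"
  shows "\<exists>w \<in> lists letters. word_val G w = g"
proof -
  have "g \<in> generate G \<Sigma>" using assms gens_generate by simp
  then show ?thesis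
  proof (induction rule: generate.induct)
    case one
    show ?case by (rule bexI[of _ "[]"]) auto
  next
    case (incl h)
    then have "h \<in> letters" by (simp add: sym_gens_def)
    then show ?case by (intro bexI[of _ "[h]"]) (auto simp: letters_closed)
  next
    case (inv h)
    then have "m_inv G h \<in> letters" by (simp add: sym_gens_def)
    then show ?case by (intro bexI[of _ "[m_inv G h]"]) (auto simp: letters_closed)
  next
    case (eng h1 h2)
    then obtain w1 w2 where "w1 \<in> lists letters" "word_val G w1 = h1"
      "w2 \<in> lists letters" "word_val G w2 = h2" by blast
    then show ?case by (intro bexI[of _ "w1 @ w2"]) (auto simp: word_val_append)
  qed
qed

lemma arcs_ends_cayley:
  "arcs_ends cgraph = {(g, g \<otimes> s) | g s. g \<in> carrier G \<and> s \<in> letters}"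
  by (auto simp: arcs_ends_def arc_to_ends_def cayley_graph_def image_iff)

lemma vwalk_labelled_walk:
  assumes "g \<in> carrier G" "w \<in> lists letters"
  shows "vwalk (labelled_walk G g w) cgraph"
  using assms
proof (induction w arbitrary: g)
  case Nil
  then show ?case by (auto simp: vwalk_def cayley_graph_def)
next
  case (Cons s w)
  then have "vwalk (labelled_walk G (g \<otimes> s) w) cgraph" by (auto simp: letters_closed)
  then show ?case using Cons.prems
    by (auto intro!: vwalk_consI simp: arcs_ends_cayley) (simp add: cayley_graph_def)
qed

lemma set_labelled_walk:
  assumes "g \<in> carrier G" "w \<in> lists letters"
  shows "set (labelled_walk G g w) \<subseteq> carrier G"
  using vwalk_labelled_walk[OF assms] by (auto simp: vwalk_def cayley_graph_def)

text \<open>Every edge has the form \<open>(u, u \<otimes> s)\<close>, so a letter can be read off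
  at each step. Together with \<open>vwalk_labelled_walk\<close> this identifies walks from a given
  vertex with words.\<close>

lemma vwalk_imp_labelled_walk:
  assumes "vwalk p cgraph"
  shows "\<exists>w \<in> lists letters. p = labelled_walk G (hd p) w"
  using assms
proof (induction p rule: vwalk_induct)
  case (Base u)
  show ?case by (rule bexI[of _ "[]"]) auto
next
  case (Cons u v es)
  then obtain s w where "s \<in> letters" "v = u \<otimes> s"
    "w \<in> lists letters" "v # es = labelled_walk G v w"
    by (auto simp: arcs_ends_cayley)
  then show ?case by (intro bexI[of _ "s # w"]) auto
qed

lemma last_labelled_walk:
  assumes "g \<in> carrier G" "w \<in> lists letters"
  shows "last (labelled_walk G g w) = g \<otimes> word_val G w"
  using assms by (induction w arbitrary: g) (auto simp: letters_closed word_val_closed m_assoc)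

lemma nth_labelled_walk:
  assumes "g \<in> carrier G" "w \<in> lists letters" "i \<le> length w"
  shows "labelled_walk G g w ! i = g \<otimes> word_val G (take i w)"
  using assms
proof (induction w arbitrary: g i)
  case (Cons s w)
  then have "word_val G (take j w) \<in> carrier G" for j
    by (metis in_lists_conv_set in_set_takeD listsE word_val_closed)
  with Cons show ?case by (cases i) (auto simp: letters_closed m_assoc)
qed auto

lemma word_path_eq_labelled_walk:
  assumes "w \<in> lists letters"
  shows "word_path G w = labelled_walk G \<one> w"
proof (rule nth_equalityI)
  fix i assume "i < length (word_path G w)"
  then have i: "i \<le> length w" by (simp add: word_path_def)
  have "take i w \<in> lists letters" using assms by (auto dest: in_set_takeD)
  then show "word_path G w ! i = labelled_walk G \<one> w ! i"
    using assms i by (auto simp: nth_labelled_walk word_val_closed word_path_def nth_append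
        simp del: upt_Suc)
qed (simp add: word_path_def)

section \<open>Graph distance as word metric\<close>

text \<open>Walks from \<open>g\<close> to \<open>h\<close> of length \<open>n\<close> correspond to
  words of length \<open>n\<close> that carry \<open>g\<close> to \<open>h\<close>, so both minima
  range over the same set of lengths.\<close>

lemma dist_eq_Least:
  assumes "g \<in> carrier G"
  shows "cdist g h = (LEAST n. \<exists>w \<in> lists letters. g \<otimes> word_val G w = h \<and> length w = n)"
proof -
  have "(\<exists>p. vwalk p cgraph \<and> hd p = g \<and> last p = h \<and> vwalk_length p = n)
      \<longleftrightarrow> (\<exists>w \<in> lists letters. g \<otimes> word_val G w = h \<and> length w = n)" (is "?L \<longleftrightarrow> ?R") for n
  proof
    assume ?L
    then obtain w p where "w \<in> lists letters" "p = labelled_walk G g w" "last p = h" "vwalk_length p = n"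
      using vwalk_imp_labelled_walk by blast
    then show ?R using assms by (auto simp: last_labelled_walk intro!: bexI[of _ w])
  next
    assume ?R
    then obtain w where "w \<in> lists letters" "g \<otimes> word_val G w = h" "length w = n" by blast
    then show ?L using assms
      by (intro exI[of _ "labelled_walk G g w"]) (auto simp: last_labelled_walk vwalk_labelled_walk)
  qed
  then show ?thesis unfolding graph_dist_def by simp
qed

lemma dist_le_length:
  assumes "g \<in> carrier G" "w \<in> lists letters"
  shows "cdist g (g \<otimes> word_val G w) \<le> length w"
  unfolding dist_eq_Least[OF assms(1)] using assms by (intro Least_le) auto

text \<open>Since \<open>\<Sigma>\<close> generates, some word represents
  \<open>inv g \<otimes> h\<close>. The set of lengths is therefore nonempty and its minimum is
  realised.\<close>

lemma dist_attained:
  assumes "g \<in> carrier G" "h \<in> carrier G"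
  obtains w where "w \<in> lists letters" "g \<otimes> word_val G w = h" "length w = cdist g h"
proof -
  obtain w where w: "w \<in> lists letters" "word_val G w = inv g \<otimes> h"
    using word_val_surj[of "inv g \<otimes> h"] assms by auto
  have "g \<otimes> word_val G w = h" using assms by (simp add: w m_assoc[symmetric])
  then have "\<exists>n. \<exists>w \<in> lists letters. g \<otimes> word_val G w = h \<and> length w = n" using w by blast
  from LeastI_ex[OF this] show thesis using that unfolding dist_eq_Least[OF assms(1)] by blast
qed

lemma dist_self: "g \<in> carrier G \<Longrightarrow> cdist g g = 0"
  using dist_le_length[of g "[]"] by simp

lemma dist_triangle:
  assumes "x \<in> carrier G" "y \<in> carrier G" "z \<in> carrier G"
  shows "cdist x z \<le> cdist x y + cdist y z"
proof -
  obtain v w where v: "v \<in> lists letters" "x \<otimes> word_val G v = y" "length v = cdist x y"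
    and w: "w \<in> lists letters" "y \<otimes> word_val G w = z" "length w = cdist y z"
    using dist_attained assms by metis
  have "x \<otimes> word_val G (v @ w) = z"
    using v w assms by (metis m_assoc word_val_append word_val_closed)
  then show ?thesis using dist_le_length[of x "v @ w"] assms v w by simp
qed

section \<open>FFTP as a statement about words\<close>

lemma shorter_word_imp_not_geodesic:
  assumes "g \<in> carrier G" "w \<in> lists letters" "u \<in> lists letters"
    and "word_val G u = word_val G w" "length u < length w"
  shows "\<not> geodesic cgraph (labelled_walk G g w)"
proof -
  have "cdist g (g \<otimes> word_val G w) < length w"
    using dist_le_length[of g u] assms by simp
  then show ?thesis using assms(1,2) by (simp add: geodesic_def last_labelled_walk)
qed

lemma async_fellow_travel_labelled_walk_refl:
  assumes "g \<in> carrier G" "w \<in> lists letters"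
  shows "async_fellow_travel cgraph K (labelled_walk G g w) (labelled_walk G g w)"
proof (rule async_fellow_travel_mono[OF async_fellow_travel_refl])
  fix x assume "x \<in> set (labelled_walk G g w)"
  then show "cdist x x = 0" using set_labelled_walk[OF assms] dist_self by blast
qed simp_all

text \<open>The existence of a shorter equal word \<open>u\<close> makes the walk of
  \<open>w\<close> non-geodesic. The shorter walk that FFTP supplies starts at \<open>g\<close> too,
  hence is labelled by a word \<open>v\<close>, and cancelling \<open>g\<close> from the common end
  point gives equality of \<open>v\<close> and \<open>w\<close> in the group. The constant depends
  neither on the words nor on the initial vertex.\<close>

lemma FFTP_wordsE:
  assumes "FFTP G \<Sigma>"
  obtains K where "\<And>g w u. \<lbrakk>g \<in> carrier G; w \<in> lists letters; u \<in> lists letters;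
      word_val G u = word_val G w; length u < length w\<rbrakk> \<Longrightarrow>
      \<exists>v \<in> lists letters. word_val G v = word_val G w \<and> length v < length w \<and>
        async_fellow_travel cgraph K (labelled_walk G g w) (labelled_walk G g v)"
proof -
  obtain K where K: "\<And>p. \<lbrakk>vwalk p cgraph; \<not> geodesic cgraph p\<rbrakk> \<Longrightarrow>
      \<exists>q. vwalk q cgraph \<and> hd q = hd p \<and> last q = last p \<and>
         vwalk_length q < vwalk_length p \<and> async_fellow_travel cgraph K p q"
    using assms unfolding FFTP_def by metis
  show thesis
  proof (rule that[of K])
    fix g w u
    assume g: "g \<in> carrier G" and w: "w \<in> lists letters" and u: "u \<in> lists letters"
      "word_val G u = word_val G w" "length u < length w"
    let ?p = "labelled_walk G g w"
    obtain q where q: "vwalk q cgraph" "hd q = g" "last q = last ?p"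
      "vwalk_length q < vwalk_length ?p" "async_fellow_travel cgraph K ?p q"
      using K[OF vwalk_labelled_walk[OF g w] shorter_word_imp_not_geodesic[OF g w u]]
      unfolding hd_labelled_walk by metis
    then obtain v where v: "v \<in> lists letters" "q = labelled_walk G g v"
      using vwalk_imp_labelled_walk by metis
    have "word_val G v = word_val G w"
      using q(3) g v w by (simp add: last_labelled_walk word_val_closed)
    then show "\<exists>v \<in> lists letters. word_val G v = word_val G w \<and> length v < length w \<and>
        async_fellow_travel cgraph K ?p (labelled_walk G g v)"
      using q(4,5) v by (intro bexI[of _ v]) simp_all
  qed
qed

text \<open>As long as the word is longer than \<open>u\<close>, the word \<open>u\<close> itself
  witnesses that FFTP applies, and each application removes at least one letter. An excess of at
  most \<open>n\<close> letters thus costs at most \<open>n\<close> applications, whose constants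
  add up by transitivity.\<close>

lemma iterate_FFTP:
  assumes K: "\<And>g w u. \<lbrakk>g \<in> carrier G; w \<in> lists letters; u \<in> lists letters;
      word_val G u = word_val G w; length u < length w\<rbrakk> \<Longrightarrow>
      \<exists>v \<in> lists letters. word_val G v = word_val G w \<and> length v < length w \<and>
        async_fellow_travel cgraph K (labelled_walk G g w) (labelled_walk G g v)"
    and g: "g \<in> carrier G" and u: "u \<in> lists letters"
    and "w \<in> lists letters" "word_val G u = word_val G w" "length w \<le> length u + n"
  shows "\<exists>v \<in> lists letters. word_val G v = word_val G w \<and> length v \<le> length u \<and>
        async_fellow_travel cgraph (n * K) (labelled_walk G g w) (labelled_walk G g v)"
  using assms(4-)
proof (induction n arbitrary: w)
  case 0
  then show ?case using async_fellow_travel_labelled_walk_refl[OF g 0(1)] by auto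
next
  case (Suc n)
  have "\<exists>v \<in> lists letters. word_val G v = word_val G w \<and> length v \<le> length u + n \<and>
      async_fellow_travel cgraph K (labelled_walk G g w) (labelled_walk G g v)"
  proof (cases "length u < length w")
    case True
    then obtain v where v: "v \<in> lists letters" "word_val G v = word_val G w" "length v < length w"
      "async_fellow_travel cgraph K (labelled_walk G g w) (labelled_walk G g v)"
      using K[OF g Suc.prems(1) u Suc.prems(2)] by blast
    have "length v \<le> length u + n" using v(3) Suc.prems(3) by simp
    then show ?thesis using v by blast
  next
    \<comment> \<open>Here \<open>w\<close> is already short enough and is kept; it fellow travels
      with itself for any constant.\<close>
    case False
    then show ?thesis
      using async_fellow_travel_labelled_walk_refl[OF g Suc.prems(1)] Suc.prems(1)
      by (intro bexI[of _ w]) simp_all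
  qed
  then obtain v where v: "v \<in> lists letters" "word_val G v = word_val G w" "length v \<le> length u + n"
    "async_fellow_travel cgraph K (labelled_walk G g w) (labelled_walk G g v)" by blast
  obtain v' where v': "v' \<in> lists letters" "word_val G v' = word_val G v" "length v' \<le> length u"
    "async_fellow_travel cgraph (n * K) (labelled_walk G g v) (labelled_walk G g v')"
    using Suc.IH[OF v(1) _ v(3)] Suc.prems(2) v(2) by auto
  have "async_fellow_travel cgraph (K + n * K) (labelled_walk G g w) (labelled_walk G g v')"
    by (rule async_fellow_travel_trans[OF v(4) v'(4) _ _ _ set_labelled_walk[OF g Suc.prems(1)]
          set_labelled_walk[OF g v(1)] set_labelled_walk[OF g v'(1)] dist_triangle]) simp_all
  then show ?case using v(2) v'(1-3) by (intro bexI[of _ v']) simp_all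
qed

section \<open>Fellow travelling of walks that branch after a common prefix\<close>

lemma nth_labelled_walk_append_le:
  assumes "g \<in> carrier G" "x \<in> lists letters" "y \<in> lists letters" "i \<le> length x"
  shows "labelled_walk G g (x @ y) ! i = labelled_walk G g x ! i"
  using assms by (simp add: nth_labelled_walk)

lemma nth_labelled_walk_append_add:
  assumes "g \<in> carrier G" "x \<in> lists letters" "y \<in> lists letters" "k \<le> length y"
  shows "labelled_walk G g (x @ y) ! (length x + k) = labelled_walk G (g \<otimes> word_val G x) y ! k"
proof -
  have "take k y \<in> lists letters" using assms by (auto dest: in_set_takeD)
  then show ?thesis using assms
    by (simp add: nth_labelled_walk word_val_append word_val_closed m_assoc)
qed

text \<open>Both walks follow \<open>x\<close> to the vertex
  \<open>h = g \<otimes> word_val G x\<close>. From there \<open>x @ y\<close> continues along the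
  walk of \<open>inv b # y\<close> from \<open>h \<otimes> b\<close> stripped of its initial vertex,
  while \<open>x @ b # q\<close> crosses the edge to \<open>h \<otimes> b\<close> and then follows
  \<open>q\<close>. The given reparametrisations are shifted accordingly and extended by the
  identity along \<open>x\<close>; the additional 1 is the length of the edge between
  \<open>h\<close> and \<open>h \<otimes> b\<close>.\<close>

lemma async_fellow_travel_branch:
  assumes g: "g \<in> carrier G" and x: "x \<in> lists letters" and b: "b \<in> letters"
    and y: "y \<in> lists letters" and q: "q \<in> lists letters"
    and travel: "async_fellow_travel cgraph K
      (labelled_walk G (g \<otimes> word_val G x \<otimes> b) (inv b # y)) (labelled_walk G (g \<otimes> word_val G x \<otimes> b) q)"
  shows "async_fellow_travel cgraph (Suc K) (labelled_walk G g (x @ y)) (labelled_walk G g (x @ b # q))"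
proof -
  define n where "n = length x"
  define h where "h = g \<otimes> word_val G x"
  define P where "P = labelled_walk G (h \<otimes> b) (inv b # y)"
  define Q where "Q = labelled_walk G (h \<otimes> b) q"
  define W where "W = labelled_walk G g (x @ y)"
  define V where "V = labelled_walk G g (x @ b # q)"
  have h: "h \<in> carrier G" using g x by (simp add: h_def word_val_closed)
  have bG: "b \<in> carrier G" using b by (rule letters_closed)
  have hb: "h \<otimes> b \<otimes> inv b = h" using h bG by (simp add: m_assoc)
  have bq: "b # q \<in> lists letters"
    and xy: "x @ y \<in> lists letters"
    using b x y q by auto
  have V_lt: "V ! i = W ! i" if "i \<le> n" for i
    using that nth_labelled_walk_append_le[OF g x y] nth_labelled_walk_append_le[OF g x bq]
    by (simp add: V_def W_def n_def)
  have V_ge: "V ! (n + Suc k) = Q ! k" if "k \<le> length q" for k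
    using that nth_labelled_walk_append_add[OF g x bq, of "Suc k"]
    by (simp add: V_def Q_def n_def h_def)
  \<comment> \<open>The letter \<open>inv b\<close> leads from \<open>h \<otimes> b\<close> back to
    \<open>h\<close>, so \<open>P\<close> is one vertex ahead: \<open>W ! n\<close> is
    \<open>P ! 1\<close>.\<close>
  have W_ge: "W ! (n + k) = P ! Suc k" if "k \<le> length y" for k
    using that nth_labelled_walk_append_add[OF g x y, of k]
    by (simp add: W_def P_def n_def h_def[symmetric] hb)
  have P0: "P ! 0 = h \<otimes> b" by (simp add: P_def)
  have lens: "vwalk_length P = Suc (length y)" "vwalk_length Q = length q"
    "vwalk_length W = n + length y" "vwalk_length V = Suc (n + length q)"
    by (auto simp: P_def Q_def W_def V_def n_def)
  have carr_W: "W ! i \<in> carrier G" if "i \<le> n + length y" for i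
    using subsetD[OF set_labelled_walk[OF g xy] nth_mem] that unfolding W_def n_def by simp
  have carr_Q: "Q ! i \<in> carrier G" if "i \<le> length q" for i
    using subsetD[OF set_labelled_walk[of "h \<otimes> b" q] nth_mem] that h bG q unfolding Q_def by simp
  have self: "cdist (W ! i) (W ! i) = 0" if "i \<le> n" for i
    using carr_W that by (simp add: dist_self)
  obtain f e where f_fun: "f \<in> {0..Suc (length y)} \<rightarrow> {0..length q}"
    and f_mono: "mono_on {0..Suc (length y)} f"
    and e_fun: "e \<in> {0..length q} \<rightarrow> {0..Suc (length y)}"
    and e_mono: "mono_on {0..length q} e"
    and f_near: "\<forall>i\<in>{0..Suc (length y)}. cdist (P ! i) (Q ! f i) \<le> K"
    and e_near: "\<forall>j\<in>{0..length q}. cdist (Q ! j) (P ! e j) \<le> K"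
    using travel unfolding async_fellow_travel_def h_def[symmetric] P_def[symmetric] Q_def[symmetric] lens
    by blast
  have f: "f i \<le> length q" and fK: "cdist (P ! i) (Q ! f i) \<le> K" if "i \<le> Suc (length y)" for i
    using that f_fun f_near by (auto simp: Pi_iff)
  have e: "e j \<le> Suc (length y)" and eK: "cdist (Q ! j) (P ! e j) \<le> K" if "j \<le> length q" for j
    using that e_fun e_near by (auto simp: Pi_iff)
  \<comment> \<open>The initial vertex \<open>h \<otimes> b\<close> of \<open>P\<close> need not be on \<open>W\<close>; it is replaced by its neighbour \<open>h = W ! n\<close>,
    using the truncated subtraction \<open>0 - 1 = 0\<close>.\<close>
  define f' where "f' i = (if i < n then i else n + Suc (f (Suc (i - n))))" for i
  define e' where "e' j = (if j \<le> n then j else n + (e (j - Suc n) - 1))" for j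
  \<comment> \<open>For \<open>k = 0\<close> this is the edge labelled \<open>inv b\<close> from
    \<open>h \<otimes> b\<close> to \<open>h\<close>; for positive \<open>k\<close> the two vertices
    coincide.\<close>
  have P_near: "cdist (P ! k) (W ! (n + (k - 1))) \<le> 1" if k: "k \<le> Suc (length y)" for k
  proof (cases k)
    case 0
    have "W ! n = h" using W_ge[of 0] by (simp add: P_def hb hd_conv_nth[symmetric])
    then show ?thesis
      using 0 dist_le_length[of "h \<otimes> b" "[inv b]"] inv_letters[OF b] h bG hb by (simp add: P0)
  next
    case (Suc k')
    then show ?thesis using W_ge[of k'] k carr_W[of "n + k'"] by (simp add: dist_self)
  qed
  have carr_P: "P ! k \<in> carrier G" if k: "k \<le> Suc (length y)" for k
  proof (cases k)
    case 0
    then show ?thesis using P0 h bG by simp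
  next
    case (Suc k')
    then show ?thesis using W_ge[of k'] k carr_W[of "n + k'"] by simp
  qed
  show ?thesis unfolding async_fellow_travel_def W_def[symmetric] V_def[symmetric] lens
  proof (rule exI[of _ f'], rule exI[of _ e'], intro conjI ballI)
    show "f' \<in> {0..n + length y} \<rightarrow> {0..Suc (n + length q)}"
      using f by (auto simp: f'_def)
    show "e' \<in> {0..Suc (n + length q)} \<rightarrow> {0..n + length y}"
    proof
      fix j assume "j \<in> {0..Suc (n + length q)}"
      then have "e (j - Suc n) \<le> Suc (length y)" by (intro e) auto
      then have "e (j - Suc n) - 1 \<le> length y" by linarith
      then show "e' j \<in> {0..n + length y}" by (simp add: e'_def)
    qed
    show "mono_on {0..n + length y} f'"
    proof (rule mono_onI)
      fix i j assume ij: "i \<in> {0..n + length y}" "j \<in> {0..n + length y}" "i \<le> j"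
      show "f' i \<le> f' j"
      proof (cases "i < n")
        case False
        then have "f (Suc (i - n)) \<le> f (Suc (j - n))" using ij
          by (intro mono_onD[OF f_mono]) auto
        then show ?thesis using False ij by (simp add: f'_def)
      qed (use ij in \<open>auto simp: f'_def\<close>)
    qed
    show "mono_on {0..Suc (n + length q)} e'"
    proof (rule mono_onI)
      fix i j assume ij: "i \<in> {0..Suc (n + length q)}" "j \<in> {0..Suc (n + length q)}" "i \<le> j"
      show "e' i \<le> e' j"
      proof (cases "i \<le> n")
        case False
        then have "e (i - Suc n) \<le> e (j - Suc n)" using ij
          by (intro mono_onD[OF e_mono]) auto
        then have "e (i - Suc n) - 1 \<le> e (j - Suc n) - 1" by (rule diff_le_mono)
        then show ?thesis using False ij by (simp add: e'_def)
      qed (use ij in \<open>auto simp: e'_def\<close>)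
    qed
  next
    fix i assume i: "i \<in> {0..n + length y}"
    show "cdist (W ! i) (V ! f' i) \<le> Suc K"
    proof (cases "i < n")
      case True
      then show ?thesis by (simp add: f'_def V_lt self)
    next
      \<comment> \<open>This includes \<open>i = n\<close>, as \<open>W ! n\<close> equals
        \<open>P ! 1\<close>. The whole of \<open>W\<close> from there on lies on \<open>P\<close>,
        so this direction is bounded by \<open>K\<close> alone.\<close>
      case False
      define k where "k = i - n"
      have k: "i = n + k" "k \<le> length y" using False i by (auto simp: k_def)
      have "V ! f' i = Q ! f (Suc k)" using V_ge[of "f (Suc k)"] f[of "Suc k"] k by (simp add: f'_def)
      then show ?thesis using fK[of "Suc k"] W_ge[OF k(2)] k by simp
    qed
  next
    fix j assume j: "j \<in> {0..Suc (n + length q)}"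
    show "cdist (V ! j) (W ! e' j) \<le> Suc K"
    proof (cases "j \<le> n")
      case True
      then show ?thesis by (simp add: e'_def V_lt self)
    next
      case False
      define k where "k = j - Suc n"
      have k: "j = n + Suc k" "k \<le> length q" using False j by (auto simp: k_def)
      have e'j: "e' j = n + (e k - 1)" using k by (simp add: e'_def)
      have "e k - 1 \<le> length y" using e[OF k(2)] by simp
      then have "W ! e' j \<in> carrier G" using e'j carr_W by simp
      \<comment> \<open>The detour through \<open>P ! e k\<close> accounts for the successor in
        \<open>Suc K\<close>: its second leg has length at most 1 by \<open>P_near\<close>.\<close>
      then have "cdist (Q ! k) (W ! e' j) \<le> cdist (Q ! k) (P ! e k) + cdist (P ! e k) (W ! e' j)"
        by (rule dist_triangle[OF carr_Q[OF k(2)] carr_P[OF e[OF k(2)]]])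
      then show ?thesis using eK[OF k(2)] P_near[OF e[OF k(2)]] V_ge[OF k(2)] k e'j by simp
    qed
  qed
qed

section \<open>Words that are not shortlex minimal\<close>

text \<open>If there were no such \<open>u\<close>, totality would put \<open>w\<close> below every
  other word for its element. By asymmetry only one word has this property, so the description
  \<open>shortlex_rep\<close> would denote \<open>w\<close>.\<close>

lemma smaller_word_if_not_shortlex:
  assumes w: "w \<in> lists letters" "w \<notin> shortlex_words G \<Sigma> r"
    and r: "strict_linear_order_on letters r"
  shows "\<exists>u \<in> lists letters. word_val G u = word_val G w \<and> (u, w) \<in> lenlex r"
proof (rule ccontr)
  assume no: "\<not> ?thesis"
  have tot: "total_on (lists letters) (lenlex r)"
    using r total_on_lenlex by (auto simp: strict_linear_order_on_def)
  have "trans r" "irrefl r" using r by (auto simp: strict_linear_order_on_def)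
  then have asym: "(v, w) \<notin> lenlex r" if "(w, v) \<in> lenlex r" for v w
    using that by (metis irreflD lenlex_irreflexive lenlex_trans)
  have min: "w = v \<or> (w, v) \<in> lenlex r" if "v \<in> lists letters" "word_val G v = word_val G w" for v
    using no that w(1) tot unfolding total_on_def by blast
  have "shortlex_rep G \<Sigma> r (word_val G w) = w"
    unfolding shortlex_rep_def
  proof (rule the_equality)
    show "v = w" if "v \<in> lists letters \<and> word_val G v = word_val G w \<and>
        (\<forall>u \<in> lists letters. word_val G u = word_val G w \<longrightarrow> v = u \<or> (v, u) \<in> lenlex r)" for v
      using that min asym w(1) by blast
  qed (use w(1) min in blast)
  then have "w \<in> shortlex_words G \<Sigma> r"
    unfolding shortlex_words_def using word_val_closed[OF w(1)] by (metis imageI)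
  then show False using w(2) by contradiction
qed

lemma smaller_word_same_lengthE:
  assumes "(u, w) \<in> lenlex r" "length u = length w"
  obtains x a b w' u' where "w = x @ a # w'" "u = x @ b # u'" "(b, a) \<in> r" "length u' = length w'"
  using assms by (auto simp: lenlex_conv lex_conv)

end

section \<open>From FFTP to SL-FFTP\<close>

theorem lemma3p5:
  fixes G :: "('a, 'b) monoid_scheme" (structure)
    and \<Sigma> :: "'a set"
    and r :: "('a \<times> 'a) set"
  assumes "group G"
    and "finite \<Sigma>" and "\<Sigma> \<subseteq> carrier G" and "generate G \<Sigma> = carrier G"
    and "r \<subseteq> sym_gens G \<Sigma> \<times> sym_gens G \<Sigma>"
    and "strict_linear_order_on (sym_gens G \<Sigma>) r"
    and "FFTP G \<Sigma>"
  shows "SL_FFTP G \<Sigma> r"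
proof -
  interpret cayley G \<Sigma>
    using assms by (intro cayley.intro cayley_axioms.intro)
  obtain K where K: "\<And>g w u. \<lbrakk>g \<in> carrier G; w \<in> lists letters; u \<in> lists letters;
      word_val G u = word_val G w; length u < length w\<rbrakk> \<Longrightarrow>
      \<exists>v \<in> lists letters. word_val G v = word_val G w \<and> length v < length w \<and>
        async_fellow_travel cgraph K (labelled_walk G g w) (labelled_walk G g v)"
    using FFTP_wordsE[OF assms(7)] by metis
  \<comment> \<open>The summand \<open>2 * K\<close> stands for two applications of FFTP, the
    successor for the edge labelled \<open>b\<close> in
    \<open>async_fellow_travel_branch\<close>.\<close>
  have "\<exists>v \<in> lists letters. async_fellow_travel cgraph (Suc (2 * K)) (word_path G w) (word_path G v) \<and>
      word_val G w = word_val G v \<and> (v, w) \<in> lenlex r"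
    if w: "w \<in> lists letters" "w \<notin> shortlex_words G \<Sigma> r" for w
  proof -
    obtain u where u: "u \<in> lists letters" "word_val G u = word_val G w" "(u, w) \<in> lenlex r"
      using smaller_word_if_not_shortlex[OF w assms(6)] by blast
    show ?thesis
    proof (cases "length u < length w")
      \<comment> \<open>Now \<open>w\<close> is not geodesic, and the word given by FFTP is shortlex
        smaller by its length alone.\<close>
      case True
      then obtain v where v: "v \<in> lists letters" "word_val G v = word_val G w" "length v < length w"
        "async_fellow_travel cgraph K (labelled_walk G \<one> w) (labelled_walk G \<one> v)"
        using K[OF one_closed w(1) u(1,2)] by blast
      have "async_fellow_travel cgraph (Suc (2 * K)) (labelled_walk G \<one> w) (labelled_walk G \<one> v)"
        using v(4) by (rule async_fellow_travel_mono) simp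
      then show ?thesis
        using v w(1) by (intro bexI[of _ v]) (auto simp: word_path_eq_labelled_walk lenlex_conv)
    next
      case False
      then have "length u = length w" using lenlex_length[OF u(3)] by simp
      then obtain x a b w' u' where split: "w = x @ a # w'" "u = x @ b # u'"
        and ba: "(b, a) \<in> r" and len: "length u' = length w'"
        using smaller_word_same_lengthE[OF u(3)] by metis
      have x: "x \<in> lists letters" and a: "a \<in> letters" and w': "w' \<in> lists letters"
        and b: "b \<in> letters" and u': "u' \<in> lists letters"
        using w(1) u(1) split by auto
      have carr: "word_val G x \<in> carrier G" "a \<in> carrier G" "b \<in> carrier G"
        "word_val G w' \<in> carrier G" "word_val G u' \<in> carrier G"
        using x a b w' u' by (auto simp: word_val_closed letters_closed)
      have "word_val G x \<otimes> (b \<otimes> word_val G u') = word_val G x \<otimes> (a \<otimes> word_val G w')"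
        using u(2) x a b w' u' by (simp add: split word_val_append)
      then have eq: "b \<otimes> word_val G u' = a \<otimes> word_val G w'" using carr by simp
      have val: "word_val G u' = word_val G (inv b # a # w')"
        using carr by (simp add: eq[symmetric] m_assoc[symmetric])
      \<comment> \<open>\<open>iterate_FFTP\<close> with \<open>n = 2\<close> and reference word
        \<open>u'\<close>: as \<open>u'\<close> and \<open>w'\<close> have equal length,
        \<open>inv b # a # w'\<close> is two letters longer than \<open>u'\<close>. The factor
        \<open>\<one>\<close> in the initial vertex matches
        \<open>async_fellow_travel_branch\<close> at \<open>g = \<one>\<close>.\<close>
      have "\<exists>q \<in> lists letters. word_val G q = word_val G (inv b # a # w') \<and> length q \<le> length u' \<and>
          async_fellow_travel cgraph (2 * K) (labelled_walk G (\<one> \<otimes> word_val G x \<otimes> b) (inv b # a # w'))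
            (labelled_walk G (\<one> \<otimes> word_val G x \<otimes> b) q)"
        using K carr u' a w' inv_letters[OF b] val len by (intro iterate_FFTP) auto
      then obtain q where q: "q \<in> lists letters" "word_val G q = word_val G (inv b # a # w')"
        "length q \<le> length u'" and travel: "async_fellow_travel cgraph (2 * K)
          (labelled_walk G (\<one> \<otimes> word_val G x \<otimes> b) (inv b # a # w'))
          (labelled_walk G (\<one> \<otimes> word_val G x \<otimes> b) q)" by blast
      have v: "x @ b # q \<in> lists letters" using x b q by auto
      have "async_fellow_travel cgraph (Suc (2 * K)) (word_path G w) (word_path G (x @ b # q))"
        using async_fellow_travel_branch[OF one_closed x b _ q(1) travel] a w' w(1) v
        by (simp add: word_path_eq_labelled_walk split)
      moreover have "word_val G w = word_val G (x @ b # q)"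
        using x a b w' q(1) q(2)[folded val] by (simp add: split word_val_append eq)
      \<comment> \<open>If \<open>q\<close> is as long as \<open>w'\<close>, the letters
        \<open>b\<close> and \<open>a\<close> decide whatever follows them; irreflexivity of
        \<open>r\<close> allows the prefix \<open>x\<close> to be cancelled. Otherwise
        \<open>q\<close> is shorter than \<open>w'\<close> and length decides.\<close>
      moreover have "(x @ b # q, w) \<in> lenlex r"
      proof (cases "length q = length w'")
        case True
        have "irrefl r" using assms(6) by (simp add: strict_linear_order_on_def)
        then show ?thesis using ba True by (simp add: split Cons_lenlex_iff)
      next
        case False
        then show ?thesis using q(3) len by (simp add: split lenlex_conv)
      qed
      ultimately show ?thesis using v by blast
    qed
  qed
  then show ?thesis unfolding SL_FFTP_def by blast
qed

end
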